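(* In general, two $k$-regular graphs of the same order may have different elliptic Sombor energy; that is, there exist a positive integer $k$ and two $k$-regular simple graphs $G$ and $H$ with the same number of vertices such that $E_{ESO}(G)\ne E_{ESO}(H)$.
   Context: For a simple graph $G$ with vertex set $\{v_1,\ldots,v_n\}$, let $d_i$ denote the degree of $v_i$. The elliptic Sombor matrix $A_{ESO}(G)$ is the $n\times n$ real symmetric matrix whose $(i,j)$-entry is $(d_i+d_j)\sqrt{d_i^2+d_j^2}$ if $v_i$ and $v_j$ are adjacent, and $0$ otherwise. The elliptic Sombor energy is $E_{ESO}(G)=\sum_{i=1}^n|\lambda_i|$, where $\lambda_1,\ldots,\lambda_n$ are the eigenvalues of $A_{ESO}(G)$ counted with multiplicity. *)

theory Defs
  imports "Graph_Theory.Pair_Digraph" "Jordan_Normal_Form.Char_Poly" Complex_Main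
begin

text \<open>
  A simple graph is a \<open>pair_graph\<close>: a finite, loop-free, symmetric digraph without parallel arcs.
  Each edge is represented by its two arcs, so the degree of a vertex is its out-degree.
\<close>

abbreviation degr :: "'a pair_pre_digraph \<Rightarrow> 'a \<Rightarrow> nat" where
  "degr G v \<equiv> out_degree (with_proj G) v"

definition regular_graph :: "nat \<Rightarrow> 'a pair_pre_digraph \<Rightarrow> bool" where
  "regular_graph k G \<longleftrightarrow> pair_graph G \<and> (\<forall>v \<in> pverts G. degr G v = k)"

definition eso_weight :: "'a pair_pre_digraph \<Rightarrow> 'a \<Rightarrow> 'a \<Rightarrow> real" where
  "eso_weight G u v =
    (if (u, v) \<in> parcs G
     then (real (degr G u) + real (degr G v)) * sqrt ((real (degr G u))\<^sup>2 + (real (degr G v))\<^sup>2)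
     else 0)"

text \<open>
  The vertices \<open>v\<^sub>1, \<dots>, v\<^sub>n\<close> are enumerated in increasing order. Any other enumeration
  gives a permutation-similar matrix, hence the same eigenvalues and the same energy.
\<close>

definition eso_matrix :: "'a::linorder pair_pre_digraph \<Rightarrow> real mat" where
  "eso_matrix G =
    (let vs = sorted_list_of_set (pverts G); n = card (pverts G)
     in mat n n (\<lambda>(i, j). eso_weight G (vs ! i) (vs ! j)))"

text \<open>
  The matrix is real symmetric, so all its complex eigenvalues are real and it suffices to sum
  over the real ones; the multiplicity of an eigenvalue is its order as a root of the
  characteristic polynomial.
\<close>

definition eso_energy :: "'a::linorder pair_pre_digraph \<Rightarrow> real" where
  "eso_energy G =
    (\<Sum>x \<in> {x. eigenvalue (eso_matrix G) x}.
       real (order x (char_poly (eso_matrix G))) * \<bar>x\<bar>)"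

end

theory Submission
  imports Defs
begin

text \<open>
  In a \<open>k\<close>-regular graph every edge has the same weight \<open>2k \<cdot> \<surd>(2k\<^sup>2) = 2\<surd>2 \<cdot> k\<^sup>2\<close>, so the
  elliptic Sombor energy is \<open>2\<surd>2 \<cdot> k\<^sup>2\<close> times the sum of the absolute values of the ordinary
  adjacency eigenvalues. It is therefore enough to find two regular graphs of equal degree and
  order whose adjacency energies differ. Such a pair is formed by the two cubic graphs
  on six vertices: the complete bipartite graph \<open>K\<^sub>3\<^sub>,\<^sub>3\<close>, with spectrum
  \<open>3, 0, 0, 0, 0, -3\<close>, and the triangular prism, with spectrum \<open>3, 1, 0, 0, -2, -2\<close>. The sums of
  absolute values are \<open>6\<close> and \<open>8\<close>, and the common edge weight is \<open>18\<surd>2\<close>.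

  Both spectra come from one computation. Arrange the six vertices as two layers of three. The
  adjacency matrix of either graph has a \<open>3 \<times> 3\<close> block \<open>B\<close> for each layer and the same block \<open>C\<close> in
  both places between the layers, and each block has one constant value on its diagonal and one
  off it. All
  matrices of this shape commute, and a single basis diagonalises them: the symmetric and
  antisymmetric combinations of the two layers, tensored with the all-ones vector and two vectors of
  coordinate sum zero. Lemma \<open>layer_mat_basis\<close> verifies this, \<open>char_poly_layer_mat\<close> turns it into a
  factorised characteristic polynomial, and \<open>eso_energy_eq_sum_list\<close> reads the energy off the
  factors.
\<close>

section \<open>Energy from a list of eigenvalues\<close>

lemma order_prod_linear_factors:
  fixes x :: "'a::idom"
  shows "order x (\<Prod>a\<leftarrow>as. [:- a, 1:]) = count_list as x"
proof (induction as)
  case Nil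
  then show ?case by (simp add: order_0I)
next
  case (Cons a as)
  have nz: "(\<Prod>a\<leftarrow>as. [:- a, 1:]) \<noteq> 0"
    by (auto simp: prod_list_zero_iff)
  have "order x [:- a, 1:] = (if a = x then 1 else 0)"
    using order_power_n_n[of x 1] by (auto intro: order_0I)
  moreover have "order x ([:- a, 1:] * (\<Prod>a\<leftarrow>as. [:- a, 1:])) =
      order x [:- a, 1:] + order x (\<Prod>a\<leftarrow>as. [:- a, 1:])"
    using nz by (intro order_mult no_zero_divisors) auto
  ultimately show ?case
    using Cons by (simp del: mult_pCons_left)
qed

lemma sum_list_eq_sum_count_list:
  fixes f :: "'a \<Rightarrow> 'b::semiring_1"
  shows "(\<Sum>a\<leftarrow>as. f a) = (\<Sum>x\<in>set as. of_nat (count_list as x) * f x)"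
proof -
  \<comment> \<open>The summation range must not shrink with the list in the induction, hence a fixed superset.\<close>
  have "(\<Sum>a\<leftarrow>as. f a) = (\<Sum>x\<in>X. of_nat (count_list as x) * f x)"
    if "finite X" "set as \<subseteq> X" for X
    using that
  proof (induction as)
    case (Cons a as)
    have "(\<Sum>x\<in>X. of_nat (count_list (a # as) x) * f x) =
        (\<Sum>x\<in>X. (if x = a then f x else 0) + of_nat (count_list as x) * f x)"
      by (intro sum.cong) (auto simp: distrib_right)
    with Cons show ?case
      by (simp add: sum.distrib)
  qed simp
  then show ?thesis by simp
qed

text \<open>
  The energy is a sum over distinct eigenvalues weighted by root order. If the characteristic
  polynomial splits into the factors of a list, the root order is the number of occurrences in that
  list, so the weights disappear when the sum runs over the list with its repetitions.
\<close>

lemma eso_energy_eq_sum_list: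
  assumes cp: "char_poly (eso_matrix G) = (\<Prod>a\<leftarrow>as. [:- a, 1:])"
  shows "eso_energy G = (\<Sum>a\<leftarrow>as. \<bar>a\<bar>)"
proof -
  have "eso_matrix G \<in> carrier_mat (card (pverts G)) (card (pverts G))"
    by (simp add: eso_matrix_def Let_def)
  then have "{x. eigenvalue (eso_matrix G) x} = set as"
    by (auto simp: eigenvalue_root_char_poly cp poly_prod_list prod_list_zero_iff)
  then show ?thesis
    by (simp add: eso_energy_def cp order_prod_linear_factors sum_list_eq_sum_count_list)
qed

section \<open>Regular graphs on an initial segment of the naturals\<close>

definition graph_of :: "nat \<Rightarrow> (nat \<Rightarrow> nat \<Rightarrow> bool) \<Rightarrow> nat pair_pre_digraph" where
  "graph_of n R = \<lparr>pverts = {..<n}, parcs = {(u, v). u < n \<and> v < n \<and> R u v}\<rparr>"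

lemma degr_graph_of:
  assumes "v < n"
  shows "degr (graph_of n R) v = card {w \<in> {..<n}. R v w}"
proof -
  have "out_arcs (with_proj (graph_of n R)) v = Pair v ` {w \<in> {..<n}. R v w}"
    using assms by (auto simp: out_arcs_def graph_of_def)
  then show ?thesis
    by (simp add: out_degree_def card_image inj_on_def)
qed

lemma regular_graph_graph_of:
  assumes "symp R" "irreflp R" "\<And>v. v < n \<Longrightarrow> card {w \<in> {..<n}. R v w} = k"
  shows "regular_graph k (graph_of n R)"
proof -
  have "finite {(u, v). u < n \<and> v < n \<and> R u v}"
    by (rule finite_subset[of _ "{..<n} \<times> {..<n}"]) auto
  then have "pair_graph (graph_of n R)"
    using assms(1,2)
    by unfold_locales (auto simp: graph_of_def symmetric_def sym_def symp_def irreflp_def)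
  then show ?thesis
    using assms(3) degr_graph_of by (auto simp: regular_graph_def) (auto simp: graph_of_def degr_graph_of)
qed

text \<open>
  Regularity makes the edge weight constant: \<open>(k + k) \<cdot> \<surd>(k\<^sup>2 + k\<^sup>2) = 2k \<cdot> \<surd>2 \<cdot> k\<close>. The matrix is thus a
  multiple of the adjacency matrix.
\<close>

lemma eso_matrix_graph_of:
  assumes "\<And>v. v < n \<Longrightarrow> card {w \<in> {..<n}. R v w} = k"
  shows "eso_matrix (graph_of n R) =
    mat n n (\<lambda>(i, j). if R i j then 2 * sqrt 2 * (real k)\<^sup>2 else 0)"
proof -
  have vs: "sorted_list_of_set (pverts (graph_of n R)) = [0..<n]"
    by (simp add: graph_of_def lessThan_atLeast0)
  have "sqrt (2 * (real k)\<^sup>2) = sqrt 2 * real k"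
    by (simp add: real_sqrt_mult)
  then have "eso_weight (graph_of n R) i j = (if R i j then 2 * sqrt 2 * (real k)\<^sup>2 else 0)"
    if "i < n" "j < n" for i j
    using that assms
    by (simp add: eso_weight_def degr_graph_of) (simp add: graph_of_def power2_eq_square)
  then show ?thesis
    unfolding eso_matrix_def vs Let_def
    by (intro eq_matI) (simp_all add: graph_of_def)
qed

section \<open>Two-layer matrices\<close>

text \<open>
  Index \<open>i\<close> stands for the vertex in layer \<open>i div 3\<close> and column \<open>i mod 3\<close>. The parameter \<open>b\<close> joins
  different vertices of one layer, \<open>c\<close> joins the two vertices of a column, and \<open>d\<close> joins vertices
  that differ in both coordinates.
\<close>

definition layer_mat :: "real \<Rightarrow> real \<Rightarrow> real \<Rightarrow> real mat" where
  "layer_mat b c d = mat 6 6 (\<lambda>(i, j).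
     if i div 3 = j div 3 then (if i = j then 0 else b)
     else (if i mod 3 = j mod 3 then c else d))"

text \<open>
  The columns are the tensor products of \<open>(1, 1)\<close> and \<open>(1, -1)\<close>, the eigenvectors of the exchange of
  the layers, with \<open>(1, 1, 1)\<close>, \<open>(1, -1, 0)\<close> and \<open>(0, 1, -1)\<close>, which are eigenvectors of every
  \<open>3 \<times> 3\<close> matrix with one value on the diagonal and one off it.
\<close>

definition layer_basis :: "real mat" where
  "layer_basis = mat_of_rows_list 6
    [[1,  1,  0,  1,  1,  0],
     [1, -1,  1,  1, -1,  1],
     [1,  0, -1,  1,  0, -1],
     [1,  1,  0, -1, -1,  0],
     [1, -1,  1, -1,  1, -1],
     [1,  0, -1, -1,  0,  1]]"

definition layer_basis_inv :: "real mat" where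
  "layer_basis_inv = (1 / 6) \<cdot>\<^sub>m mat_of_rows_list 6
    [[1,  1,  1,  1,  1,  1],
     [2, -1, -1,  2, -1, -1],
     [1,  1, -2,  1,  1, -2],
     [1,  1,  1, -1, -1, -1],
     [2, -1, -1, -2,  1,  1],
     [1,  1, -2, -1, -1,  2]]"

text \<open>
  The blocks \<open>B\<close> and \<open>C\<close> of \<open>layer_mat b c d\<close> have eigenvalues \<open>2b\<close> and \<open>c + 2d\<close> on the all-ones
  vector, and \<open>-b\<close> and \<open>c - d\<close> on vectors of sum zero. On symmetric combinations of the
  layers the matrix acts as \<open>B + C\<close>, on antisymmetric ones as \<open>B - C\<close>. The order of the list follows
  the columns of \<open>layer_basis\<close>.
\<close>

definition layer_eigenvalues :: "real \<Rightarrow> real \<Rightarrow> real \<Rightarrow> real list" where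
  "layer_eigenvalues b c d =
    [2 * b + (c + 2 * d), (c - d) - b, (c - d) - b,
     2 * b - (c + 2 * d), - b - (c - d), - b - (c - d)]"

lemma less_six_cases:
  "(i::nat) < 6 \<longleftrightarrow> i = 0 \<or> i = 1 \<or> i = 2 \<or> i = 3 \<or> i = 4 \<or> i = 5"
  by auto

text \<open>
  Products of explicit matrices are compared entry by entry. The indices are enumerated before any
  entry is unfolded, so that every entry is evaluated at numerals and no case distinction on a
  symbolic index arises.
\<close>

lemma eq_mat6I:
  assumes "A \<in> carrier_mat 6 6" "B \<in> carrier_mat 6 6"
    and "\<forall>i \<in> {0, 1, 2, 3, 4, 5}. \<forall>j \<in> {0, 1, 2, 3, 4, 5}. A $$ (i, j) = B $$ (i, j)"
  shows "A = B"
proof -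
  have "A $$ (i, j) = B $$ (i, j)" if "i < 6" "j < 6" for i j
  proof -
    have "i \<in> {0, 1, 2, 3, 4, 5}" "j \<in> {0, 1, 2, 3, 4, 5}"
      using that by auto
    with assms(3) show ?thesis by blast
  qed
  then show ?thesis
    using assms(1,2) by (intro eq_matI) auto
qed

lemma times_mat6_index:
  assumes "A \<in> carrier_mat 6 6" "B \<in> carrier_mat 6 6" "i < 6" "j < 6"
  shows "(A * B) $$ (i, j) =
    A $$ (i, 0) * B $$ (0, j) + A $$ (i, 1) * B $$ (1, j) + A $$ (i, 2) * B $$ (2, j) +
    A $$ (i, 3) * B $$ (3, j) + A $$ (i, 4) * B $$ (4, j) + A $$ (i, 5) * B $$ (5, j)"
proof -
  have "{0..<6::nat} = {0, 1, 2, 3, 4, 5}"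
    by auto
  then show ?thesis
    using assms by (simp add: scalar_prod_def add.assoc)
qed

lemma layer_carrier:
  "layer_mat b c d \<in> carrier_mat 6 6" "layer_basis \<in> carrier_mat 6 6"
  "layer_basis_inv \<in> carrier_mat 6 6"
  by (auto simp: layer_mat_def layer_basis_def layer_basis_inv_def mat_of_rows_list_def)

lemma layer_basis_inverse: "layer_basis * layer_basis_inv = 1\<^sub>m 6"
proof (rule eq_mat6I)
  show "\<forall>i \<in> {0, 1, 2, 3, 4, 5}. \<forall>j \<in> {0, 1, 2, 3, 4, 5}.
      (layer_basis * layer_basis_inv) $$ (i, j) = 1\<^sub>m 6 $$ (i, j)"
    by (simp add: times_mat6_index[OF layer_carrier(2,3)])
       (simp add: layer_basis_def layer_basis_inv_def mat_of_rows_list_def)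
qed (auto intro: mult_carrier_mat layer_carrier)

lemma layer_mat_basis:
  "layer_mat b c d * layer_basis =
     layer_basis * mat_diag 6 (\<lambda>i. layer_eigenvalues b c d ! i)"
proof (rule eq_mat6I)
  show "\<forall>i \<in> {0, 1, 2, 3, 4, 5}. \<forall>j \<in> {0, 1, 2, 3, 4, 5}.
      (layer_mat b c d * layer_basis) $$ (i, j) =
      (layer_basis * mat_diag 6 (\<lambda>i. layer_eigenvalues b c d ! i)) $$ (i, j)"
    by (simp add: times_mat6_index[OF layer_carrier(1,2)] mat_diag_mult_right[OF layer_carrier(2)],
        intro conjI)
       (simp_all add: layer_basis_def layer_mat_def mat_of_rows_list_def layer_eigenvalues_def)
qed (auto intro: mult_carrier_mat layer_carrier)

lemma char_poly_layer_mat: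
  "char_poly (layer_mat b c d) = (\<Prod>a\<leftarrow>layer_eigenvalues b c d. [:- a, 1:])"
proof -
  define D where "D = mat_diag 6 (\<lambda>i. layer_eigenvalues b c d ! i)"
  have D: "D \<in> carrier_mat 6 6"
    by (simp add: D_def)
  note carr = layer_carrier(1)[of b c d] layer_carrier(2,3) D
  have "layer_mat b c d = layer_mat b c d * (layer_basis * layer_basis_inv)"
    using carr by (simp add: layer_basis_inverse)
  also have "\<dots> = layer_basis * D * layer_basis_inv"
    using carr by (simp add: layer_mat_basis D_def flip: assoc_mult_mat)
  finally have "similar_mat (layer_mat b c d) D"
    using carr layer_basis_inverse mat_mult_left_right_inverse[OF carr(2,3) layer_basis_inverse]
    by (intro similar_matI[where P = layer_basis and Q = layer_basis_inv]) auto
  moreover have "upper_triangular D"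
    by (auto simp: D_def mat_diag_def)
  moreover have "diag_mat D = layer_eigenvalues b c d"
    by (rule nth_equalityI) (simp_all add: diag_mat_def D_def mat_diag_def layer_eigenvalues_def)
  ultimately show ?thesis
    using char_poly_similar char_poly_upper_triangular[OF D] by metis
qed

section \<open>The complete bipartite graph and the prism\<close>

definition K33 :: "nat pair_pre_digraph" where
  "K33 = graph_of 6 (\<lambda>u v. u div 3 \<noteq> v div 3)"

text \<open>
  Adjacent vertices share exactly one coordinate: two vertices of one layer form part of a triangle,
  and two vertices of one column form a rung.
\<close>

definition prism :: "nat pair_pre_digraph" where
  "prism = graph_of 6 (\<lambda>u v. (u div 3 = v div 3) \<noteq> (u mod 3 = v mod 3))"

lemma card_filter_six:
  "card {w \<in> {..<6::nat}. P w} = of_bool (P 0) + of_bool (P 1) + of_bool (P 2) +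
     of_bool (P 3) + of_bool (P 4) + of_bool (P 5)"
proof -
  have "{..<6::nat} = {0, 1, 2, 3, 4, 5}"
    by auto
  moreover have "card {w \<in> {..<6::nat}. P w} = (\<Sum>w<6. of_bool (P w))"
    by (simp add: Int_def)
  ultimately show ?thesis by simp
qed

lemma K33_neighbours:
  assumes "v < 6"
  shows "card {w \<in> {..<6::nat}. v div 3 \<noteq> w div 3} = 3"
  using assms unfolding less_six_cases card_filter_six
  by (elim disjE) simp_all

lemma prism_neighbours:
  assumes "v < 6"
  shows "card {w \<in> {..<6::nat}. (v div 3 = w div 3) \<noteq> (v mod 3 = w mod 3)} = 3"
  using assms unfolding less_six_cases card_filter_six
  by (elim disjE) simp_all

lemma regular_K33: "regular_graph 3 K33"
  unfolding K33_def using K33_neighbours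
  by (intro regular_graph_graph_of) (auto simp: symp_def irreflp_def)

lemma regular_prism: "regular_graph 3 prism"
  unfolding prism_def using prism_neighbours
  by (intro regular_graph_graph_of) (auto simp: symp_def irreflp_def)

text \<open>The value \<open>18 \<surd>2\<close> is the edge weight \<open>2\<surd>2 \<cdot> k\<^sup>2\<close> of a cubic graph.\<close>

lemma eso_matrix_K33: "eso_matrix K33 = layer_mat 0 (18 * sqrt 2) (18 * sqrt 2)"
  unfolding K33_def layer_mat_def
  by (subst eso_matrix_graph_of[where k = 3], erule K33_neighbours, rule eq_matI) auto

lemma eso_matrix_prism: "eso_matrix prism = layer_mat (18 * sqrt 2) (18 * sqrt 2) 0"
proof -
  have "eso_matrix prism =
      mat 6 6 (\<lambda>(i, j). if (i div 3 = j div 3) \<noteq> (i mod 3 = j mod 3) then 18 * sqrt 2 else 0)"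
    unfolding prism_def
    \<comment> \<open>The strong congruence rule lets the weight inside the branch be evaluated.\<close>
    by (subst eso_matrix_graph_of[where k = 3], erule prism_neighbours) (simp cong: if_cong)
  also have "\<dots> = layer_mat (18 * sqrt 2) (18 * sqrt 2) 0"
    unfolding layer_mat_def
  proof (intro cong_mat refl)
    fix i j :: nat
    have "i = j \<longleftrightarrow> i div 3 = j div 3 \<and> i mod 3 = j mod 3"
      by (metis div_mult_mod_eq)
    then show "(case (i, j) of (i, j) \<Rightarrow>
          if (i div 3 = j div 3) \<noteq> (i mod 3 = j mod 3) then 18 * sqrt 2 else 0) =
        (case (i, j) of (i, j) \<Rightarrow>
          if i div 3 = j div 3 then (if i = j then 0 else 18 * sqrt 2)
          else (if i mod 3 = j mod 3 then 18 * sqrt 2 else 0))"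
      by (cases "i = j") auto
  qed
  finally show ?thesis .
qed

text \<open>The eigenvalue list is \<open>3w, 0, 0, -3w, 0, 0\<close> with \<open>w = 18 \<surd>2\<close>.\<close>

lemma eso_energy_K33: "eso_energy K33 = 108 * sqrt 2"
  by (subst eso_energy_eq_sum_list, subst eso_matrix_K33, rule char_poly_layer_mat)
     (simp add: layer_eigenvalues_def)

text \<open>The eigenvalue list is \<open>3w, 0, 0, w, -2w, -2w\<close> with \<open>w = 18 \<surd>2\<close>.\<close>

lemma eso_energy_prism: "eso_energy prism = 144 * sqrt 2"
  by (subst eso_energy_eq_sum_list, subst eso_matrix_prism, rule char_poly_layer_mat)
     (simp add: layer_eigenvalues_def)

theorem corollary3p6:
  shows "\<exists>(k::nat) (G :: nat pair_pre_digraph) (H :: nat pair_pre_digraph).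
    k > 0 \<and> regular_graph k G \<and> regular_graph k H \<and>
    card (pverts G) = card (pverts H) \<and> eso_energy G \<noteq> eso_energy H"
proof (intro exI conjI)
  show "(0::nat) < 3" by simp
  show "regular_graph 3 K33" by (rule regular_K33)
  show "regular_graph 3 prism" by (rule regular_prism)
  show "card (pverts K33) = card (pverts prism)"
    by (simp add: K33_def prism_def graph_of_def)
  show "eso_energy K33 \<noteq> eso_energy prism"
    by (simp add: eso_energy_K33 eso_energy_prism)
qed

end
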